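(* Let $n\in\mathbb{N}$ and let $\mathbf{x}=(x_2,\dots,x_{n+1})$. The $n$-th multivariate Eulerian polynomial $$A_n(\mathbf{x})=\sum_{\sigma\in\mathfrak{S}_{n+1}}\prod_{i\in\mathcal{DT}(\sigma)}x_i$$ is mirrorpalindromic, that is, $$\operatorname{rec}(A_n)(\mathbf{x})=A_n(\operatorname{mirror}(\mathbf{x})),$$ where $\operatorname{mirror}(\mathbf{x})=(x_{n+1},\dots,x_2)$, i.e. the right-hand side is obtained from $A_n$ by replacing each $x_i$ by $x_{n+3-i}$ for $i\in\{2,\dots,n+1\}$.
   Context: Notation: $[m]=\{1,\dots,m\}$ and $[a,b]=\{a,a+1,\dots,b\}$. $\mathfrak{S}_{n+1}$ is the symmetric group on $[n+1]$, with permutations written in one-line notation $\sigma=(\sigma_1\cdots\sigma_{n+1})$. The descent top set of $\sigma\in\mathfrak{S}_{n+1}$ is $\mathcal{DT}(\sigma)=\{\sigma_i \mid i\in[n],\ \sigma_i>\sigma_{i+1}\}\subseteq[2,n+1]$. Since $1$ is never a descent top, $A_n$ is regarded as a polynomial in the $n$ variables $x_2,\dots,x_{n+1}$. Reciprocal: for a multivariate real polynomial $A(\mathbf{x})$, $\operatorname{rec}(A)(\mathbf{x}):=m_A\cdot A(1/x_i)_{i}$ (every variable $x_i$ replaced by $1/x_i$), where $m_A$ is the unique monic monomial of minimum degree in the variables $\mathbf{x}$ such that this product is a polynomial. Mirror: for a tuple of variables, $\operatorname{mirror}$ reverses the order of the tuple. A polynomial $p(\mathbf{x})$ is mirrorpalindromic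 if $\operatorname{rec}(p)(\mathbf{x})=p(\operatorname{mirror}(\mathbf{x}))$. *)

theory Defs
  imports Complex_Main "HOL-Library.Poly_Mapping" "HOL-Combinatorics.Permutations"
begin

text \<open>Real polynomials in indeterminates \<open>x\<^sub>i\<close> (\<open>i :: nat\<close>): finitely supported maps from exponent
  vectors to coefficients, with the convolution product of \<^theory>\<open>HOL-Library.Poly_Mapping\<close>.
  Real Laurent polynomials are the same thing with integer exponents; they serve as the ring
  in which \<open>A(1/x\<^sub>i)\<close> lives.\<close>

type_synonym rmpoly = "(nat \<Rightarrow>\<^sub>0 nat) \<Rightarrow>\<^sub>0 real"
type_synonym rlaurent = "(nat \<Rightarrow>\<^sub>0 int) \<Rightarrow>\<^sub>0 real"

definition monomial :: "(nat \<Rightarrow>\<^sub>0 nat) \<Rightarrow> rmpoly" where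
  "monomial m = Poly_Mapping.single m 1"

definition X :: "nat \<Rightarrow> rmpoly" where
  "X i = Poly_Mapping.single (Poly_Mapping.single i 1) 1"

definition LX :: "nat \<Rightarrow> rlaurent" where
  "LX i = Poly_Mapping.single (Poly_Mapping.single i 1) 1"

definition LX_inv :: "nat \<Rightarrow> rlaurent" where
  "LX_inv i = Poly_Mapping.single (Poly_Mapping.single i (- 1)) 1"

definition vars :: "rmpoly \<Rightarrow> nat set" where
  "vars p = (\<Union>m \<in> Poly_Mapping.keys p. Poly_Mapping.keys m)"

definition mdegree :: "(nat \<Rightarrow>\<^sub>0 nat) \<Rightarrow> nat" where
  "mdegree m = (\<Sum>i \<in> Poly_Mapping.keys m. Poly_Mapping.lookup m i)"

text \<open>Substitution of \<open>f i\<close> for \<open>x\<^sub>i\<close>. The exponent type of the target ring is left open so that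
  both polynomials (\<open>'e = nat\<close>) and Laurent polynomials (\<open>'e = int\<close>) may be substituted.\<close>

definition msubst ::
  "(nat \<Rightarrow> ((nat \<Rightarrow>\<^sub>0 'e::comm_monoid_add) \<Rightarrow>\<^sub>0 real)) \<Rightarrow> rmpoly \<Rightarrow> ((nat \<Rightarrow>\<^sub>0 'e) \<Rightarrow>\<^sub>0 real)" where
  "msubst f p = (\<Sum>m \<in> Poly_Mapping.keys p.
     Poly_Mapping.single 0 (Poly_Mapping.lookup p m) *
     (\<Prod>i \<in> Poly_Mapping.keys m. f i ^ Poly_Mapping.lookup m i))"

definition to_laurent :: "rmpoly \<Rightarrow> rlaurent" where
  "to_laurent = msubst LX"

text \<open>The product \<open>m \<cdot> p(1/x\<^sub>i)\<close> for the monic monomial with exponent vector \<open>m\<close>.\<close>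

definition rec_product :: "(nat \<Rightarrow>\<^sub>0 nat) \<Rightarrow> rmpoly \<Rightarrow> rlaurent" where
  "rec_product m p = to_laurent (monomial m) * msubst LX_inv p"

text \<open>Here \<open>m\<close> ranges over monomials in all indeterminates; minimality of the total degree forces
  it to involve only indeterminates that occur in \<open>p\<close>.\<close>

definition rec_monomial :: "rmpoly \<Rightarrow> (nat \<Rightarrow>\<^sub>0 nat)" where
  "rec_monomial p = (THE m. is_arg_min mdegree (\<lambda>m. rec_product m p \<in> range to_laurent) m)"

definition reciprocal :: "rmpoly \<Rightarrow> rmpoly" where
  "reciprocal p = (THE q. to_laurent q = rec_product (rec_monomial p) p)"

text \<open>A tuple of variables is given by the list \<open>vs\<close> of its (distinct) indices, and its mirror is
  \<open>rev vs\<close>. Substituting the mirrored tuple sends the \<open>k\<close>-th variable of \<open>vs\<close> to the \<open>k\<close>-th variable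
  of \<open>rev vs\<close>; the \<open>None\<close> case is irrelevant for polynomials in the variables \<open>vs\<close>.\<close>

definition mirror_var :: "nat list \<Rightarrow> nat \<Rightarrow> nat" where
  "mirror_var vs i = (case map_of (zip vs (rev vs)) i of None \<Rightarrow> i | Some j \<Rightarrow> j)"

definition mirrorpalindromic :: "nat list \<Rightarrow> rmpoly \<Rightarrow> bool" where
  "mirrorpalindromic vs p \<longleftrightarrow>
     distinct vs \<and> vars p \<subseteq> set vs \<and> reciprocal p = msubst (\<lambda>i. X (mirror_var vs i)) p"

definition descent_tops :: "nat \<Rightarrow> (nat \<Rightarrow> nat) \<Rightarrow> nat set" where
  "descent_tops n \<sigma> = {\<sigma> i | i. i \<in> {1..n} \<and> \<sigma> i > \<sigma> (i + 1)}"

definition eulerian :: "nat \<Rightarrow> rmpoly" where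
  "eulerian n = (\<Sum>\<sigma> | \<sigma> permutes {1..n + 1}. \<Prod>i \<in> descent_tops n \<sigma>. X i)"

end

theory Submission
  imports Defs "HOL-Combinatorics.Multiset_Permutations"
begin

text \<open>
  Every monomial of the Eulerian polynomial is square-free in \<open>x\<^sub>2, \<dots>, x\<^sub>n\<^sub>+\<^sub>1\<close>, and the decreasing
  permutation contributes the product of all these variables. Hence the reciprocal replaces each
  descent top set by its complement in \<open>{2..n + 1}\<close> (\<open>reciprocal_squarefree\<close>). The claim is
  therefore that the complement of the descent top set of a random permutation is distributed like
  the mirror image of that set.

  This symmetry is hard to see on descent tops, but easy on another statistic with the same
  distribution: the set of drops \<open>{v. \<rho> v < v}\<close> of a permutation \<open>\<rho>\<close>. The value \<open>1\<close> is never a drop,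
  and for \<open>v \<ge> 2\<close> the failure \<open>\<rho> v \<ge> v\<close> means \<open>n + 2 - \<rho> v < n + 3 - v\<close>, so that \<open>n + 3 - v\<close> is a drop
  of the permutation that sends \<open>n + 3 - v\<close> to \<open>n + 2 - \<rho> v\<close>. Passing from \<open>\<rho>\<close> to that permutation is
  composition with a fixed permutation on each side, so it permutes the symmetric group
  (\<open>drops_flip\<close>, \<open>sum_descent_tops_mirror\<close>).

  The equidistribution of the two statistics (\<open>sum_tops_eq_sum_drops\<close>) is the classical one given by
  Foata's fundamental transformation. It is obtained here by inserting a new maximum \<open>M\<close>, into
  one-line notation on the one side and into the cycles on the other. In both cases one insertion
  leaves the set \<open>D\<close> unchanged, and the others produce \<open>D - {a}\<close> together with \<open>M\<close>, once for each old
  letter \<open>a\<close>. Both distributions thus obey the same recursion. Distributions are compared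
  by summing an arbitrary function \<open>g\<close> of the set, which lets \<open>g\<close> take polynomial values directly.
\<close>

section \<open>Descent tops of words\<close>

fun tops :: "'a::linorder list \<Rightarrow> 'a set" where
  "tops [] = {}"
| "tops [x] = {}"
| "tops (x # y # zs) = (if y < x then {x} else {}) \<union> tops (y # zs)"

lemma tops_subset: "tops w \<subseteq> set w"
  by (induction w rule: tops.induct) auto

lemma tops_append:
  assumes "u \<noteq> []" "v \<noteq> []"
  shows "tops (u @ v) = tops u \<union> (if hd v < last u then {last u} else {}) \<union> tops v"
  using assms(1)
proof (induction u rule: tops.induct)
  case (2 x)
  then show ?case using assms(2) by (cases v) auto
qed auto

lemma last_notin_tops: "distinct w \<Longrightarrow> w \<noteq> [] \<Longrightarrow> last w \<notin> tops w"
proof (induction w rule: tops.induct)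
  case (3 x y zs)
  then show ?case using last_in_set[of "y # zs"] by auto
qed auto

lemma tops_conv_nth: "tops w = {w ! i | i. Suc i < length w \<and> w ! Suc i < w ! i}"
proof (induction w rule: tops.induct)
  case (3 x y zs)
  have "{(x # y # zs) ! i | i. Suc i < length (x # y # zs) \<and> (x # y # zs) ! Suc i < (x # y # zs) ! i}
     = (if y < x then {x} else {}) \<union> {(y # zs) ! i | i. Suc i < length (y # zs) \<and> (y # zs) ! Suc i < (y # zs) ! i}"
    (is "?L = ?R")
  proof (intro set_eqI iffI)
    fix a assume "a \<in> ?L"
    then obtain i where i: "a = (x # y # zs) ! i" "Suc i < length (x # y # zs)"
      "(x # y # zs) ! Suc i < (x # y # zs) ! i" by blast
    then show "a \<in> ?R" by (cases i) auto
  next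
    fix a assume "a \<in> ?R"
    then consider "y < x" "a = x"
      | i where "a = (y # zs) ! i" "Suc i < length (y # zs)" "(y # zs) ! Suc i < (y # zs) ! i"
      by (auto split: if_splits)
    then show "a \<in> ?L"
    proof cases
      case 1
      then show ?thesis by (auto intro!: exI[of _ 0])
    next
      case (2 i)
      then show ?thesis by (auto intro!: exI[of _ "Suc i"])
    qed
  qed
  then show ?case using 3 by simp
qed auto

definition insert_at :: "nat \<Rightarrow> 'a \<Rightarrow> 'a list \<Rightarrow> 'a list" where
  "insert_at i a w = take i w @ a # drop i w"

lemma tops_insert_at_length:
  assumes "\<forall>a\<in>set w. a < M"
  shows "tops (insert_at (length w) M w) = tops w"
proof (cases "w = []")
  case False
  then have "last w < M" using assms by simp
  then have "\<not> M < last w" by (rule less_not_sym)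
  then show ?thesis using False by (simp add: insert_at_def tops_append)
qed (simp add: insert_at_def)

lemma tops_insert_at_0:
  assumes "\<forall>a\<in>set w. a < M" "w \<noteq> []"
  shows "tops (insert_at 0 M w) = insert M (tops w)"
  using assms by (cases w) (auto simp: insert_at_def)

text \<open>The new letter separates \<open>w ! i\<close> from its successor by something larger, so \<open>w ! i\<close> stops being a
  descent top if it was one.\<close>
lemma tops_insert_at_Suc:
  assumes "\<forall>a\<in>set w. a < M" "distinct w" "Suc i < length w"
  shows "tops (insert_at (Suc i) M w) = insert M (tops w - {w ! i})"
proof -
  define u v where "u = take (Suc i) w" and "v = drop (Suc i) w"
  have w: "w = u @ v" by (simp add: u_def v_def)
  have ne: "u \<noteq> []" "v \<noteq> []" using assms(3) by (auto simp: u_def v_def)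
  have last: "last u = w ! i"
    using assms(3) by (simp add: u_def take_Suc_conv_app_nth)
  have d: "distinct u" "set u \<inter> set v = {}" using assms(2) by (auto simp: w)
  have "last u < M" using assms(1) ne by (simp add: w)
  then have "\<not> M < last u" by (rule less_not_sym)
  then have "tops (u @ M # v) = insert M (tops u \<union> tops v)"
    using ne assms(1) tops_insert_at_0[of v M]
    by (simp add: tops_append w insert_at_def)
  moreover have "last u \<notin> tops u" using d ne last_notin_tops by blast
  moreover have "last u \<notin> tops v" using d ne tops_subset[of v] last_in_set[of u] by blast
  moreover have "tops w = tops u \<union> (if hd v < last u then {last u} else {}) \<union> tops v"
    using tops_append[OF ne] by (simp only: w)
  ultimately have "tops (u @ M # v) = insert M (tops w - {last u})"
    by (cases "hd v < last u") auto
  then have "tops (u @ M # v) = insert M (tops w - {w ! i})" by (simp only: last)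
  then show ?thesis by (simp only: insert_at_def u_def v_def)
qed

text \<open>Insertion right after a letter \<open>a\<close> other than the last one accounts for the summand of \<open>a\<close>. The
  summand of the last letter comes from insertion at the front: the last letter is no descent top,
  so removing it changes nothing.\<close>
lemma sum_tops_insert_at:
  fixes g :: "'a::linorder set \<Rightarrow> 'b::comm_monoid_add"
  assumes "\<forall>a\<in>set w. a < M" "distinct w"
  shows "(\<Sum>i\<le>length w. g (tops (insert_at i M w)))
       = g (tops w) + (\<Sum>a\<in>set w. g (insert M (tops w - {a})))"
proof (cases "length w")
  case 0
  then show ?thesis by (simp add: insert_at_def)
next
  case (Suc k)
  have w: "w \<noteq> []" using Suc by auto
  have "last w = w ! k" using Suc w by (simp add: last_conv_nth)
  then have k: "tops w - {w ! k} = tops w" using last_notin_tops[OF assms(2) w] by simp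
  have "(\<Sum>i\<le>length w. g (tops (insert_at i M w)))
      = (\<Sum>i<Suc k. g (tops (insert_at i M w))) + g (tops w)"
    using Suc tops_insert_at_length[OF assms(1)] 
    by (simp add: lessThan_Suc_atMost[symmetric] del: lessThan_Suc_atMost)
  also have "(\<Sum>i<Suc k. g (tops (insert_at i M w)))
      = g (insert M (tops w)) + (\<Sum>i<k. g (insert M (tops w - {w ! i})))"
    using Suc assms w by (simp add: sum.lessThan_Suc_shift tops_insert_at_0 tops_insert_at_Suc
        del: sum.lessThan_Suc)
  also have "\<dots> = (\<Sum>i<Suc k. g (insert M (tops w - {w ! i})))"
    using k by (simp add: add.commute)
  also have "\<dots> = (\<Sum>a\<in>set w. g (insert M (tops w - {a})))"
    by (rule sum.reindex_bij_betw[OF bij_betw_nth]) (use assms Suc in auto)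
  finally show ?thesis by (simp add: add.commute)
qed

lemma bij_betw_insert_at:
  assumes "finite S" "M \<notin> S"
  shows "bij_betw (\<lambda>(w, i). insert_at i M w) (permutations_of_set S \<times> {..card S})
           (permutations_of_set (insert M S))"
  unfolding bij_betw_def
proof
  show "inj_on (\<lambda>(w, i). insert_at i M w) (permutations_of_set S \<times> {..card S})"
  proof (rule inj_onI, clarify)
    fix w i w' i'
    assume w: "w \<in> permutations_of_set S" "w' \<in> permutations_of_set S" "i \<le> card S" "i' \<le> card S"
      and eq: "insert_at i M w = insert_at i' M w'"
    have len: "length w = card S" "length w' = card S"
      using w length_finite_permutations_of_set by auto
    have "M \<notin> set (take i w)" "M \<notin> set (drop i w)" 
      using w assms by (auto dest: permutations_of_setD in_set_takeD in_set_dropD)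
    then have *: "take i w = take i' w' \<and> drop i w = drop i' w'"
      using eq w assms append_Cons_eq_iff[of M "take i w" "drop i w" "take i' w'" "drop i' w'"]
      by (auto simp: insert_at_def)
    then have "w = w'" by (metis append_take_drop_id)
    moreover have "i = i'" using * len w
      by (metis length_take min.absorb2)
    ultimately show "w = w' \<and> i = i'" by simp
  qed
  show "(\<lambda>(w, i). insert_at i M w) ` (permutations_of_set S \<times> {..card S})
        = permutations_of_set (insert M S)"
  proof (intro equalityI subsetI)
    fix x assume "x \<in> (\<lambda>(w, i). insert_at i M w) ` (permutations_of_set S \<times> {..card S})"
    then obtain w i where w: "w \<in> permutations_of_set S" and x: "x = insert_at i M w" by auto
    have parts: "set (take i w) \<union> set (drop i w) = S" "distinct (take i w @ drop i w)"
      using permutations_of_setD[OF w] unfolding set_append[symmetric] append_take_drop_id by auto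
    then have "distinct x" using assms(2) unfolding distinct_append by (auto simp: x insert_at_def)
    moreover have "set x = insert M S" using parts(1) by (simp add: x insert_at_def)
    ultimately show "x \<in> permutations_of_set (insert M S)" by (intro permutations_of_setI)
  next
    fix x assume "x \<in> permutations_of_set (insert M S)"
    then have x: "set x = insert M S" "distinct x" by (auto dest: permutations_of_setD)
    then obtain u v where uv: "x = u @ M # v" by (metis insertI1 split_list)
    have S: "set (u @ v) = S" "distinct (u @ v)" using x assms(2) uv by auto
    then have "length (u @ v) = card S" by (metis distinct_card)
    then show "x \<in> (\<lambda>(w, i). insert_at i M w) ` (permutations_of_set S \<times> {..card S})"
      using S uv by (intro image_eqI[of _ _ "(u @ v, length u)"]) 
        (auto simp: insert_at_def)
  qed
qed

section \<open>Equidistribution of descent tops and drops\<close>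

definition drops :: "'a::linorder set \<Rightarrow> ('a \<Rightarrow> 'a) \<Rightarrow> 'a set" where
  "drops S \<rho> = {v \<in> S. \<rho> v < v}"

lemma drops_insert_fixed:
  assumes "\<rho> permutes S" "M \<notin> S"
  shows "drops (insert M S) \<rho> = drops S \<rho>"
  using assms by (auto simp: drops_def permutes_not_in)

text \<open>Composing with this transposition inserts \<open>M\<close> into the cycle of \<open>a\<close>, right after \<open>a\<close>: now \<open>a\<close> is
  sent up to \<open>M\<close>, and \<open>M\<close> down to the old image of \<open>a\<close>.\<close>
lemma drops_insert_transpose:
  assumes "\<rho> permutes S" "\<forall>a\<in>S. a < M" "a \<in> S"
  shows "drops (insert M S) (transpose M (\<rho> a) \<circ> \<rho>) = insert M (drops S \<rho> - {a})"
proof -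
  have M: "\<rho> M = M" "\<rho> a < M" using assms by (auto simp: permutes_not_in permutes_in_image)
  have "(transpose M (\<rho> a) \<circ> \<rho>) v = (if v = a then M else \<rho> v)" if "v \<in> S" for v
  proof (cases "v = a")
    case False
    then have "\<rho> v \<noteq> \<rho> a" using permutes_inj[OF assms(1)] by (auto dest: injD)
    moreover have "\<rho> v \<noteq> M" using assms that permutes_in_image[OF assms(1), of v] by fastforce
    ultimately show ?thesis using False by (simp add: transpose_def)
  qed simp
  then show ?thesis using assms M by (auto simp: drops_def dest: order.asym split: if_splits)
qed

text \<open>Summing \<open>g\<close> over all insertions of a new maximum turns it into the same function \<open>G\<close> for words and
  for permutations, so the induction hypothesis for \<open>G\<close> yields the claim for \<open>g\<close>.\<close>
lemma sum_tops_eq_sum_drops: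
  fixes g :: "'a::linorder set \<Rightarrow> 'b::comm_monoid_add"
  assumes "finite S"
  shows "(\<Sum>w\<in>permutations_of_set S. g (tops w)) = (\<Sum>\<rho> | \<rho> permutes S. g (drops S \<rho>))"
  using assms
proof (induction S arbitrary: g rule: finite_linorder_max_induct)
  case empty
  then show ?case by (simp add: drops_def)
next
  case (insert M S)
  define G where "G D = g D + (\<Sum>a\<in>S. g (Set.insert M (D - {a})))" for D
  have "M \<notin> S" using insert by auto
  have "(\<Sum>w\<in>permutations_of_set (Set.insert M S). g (tops w))
      = (\<Sum>(w, i)\<in>permutations_of_set S \<times> {..card S}. g (tops (insert_at i M w)))"
    using sum.reindex_bij_betw[OF bij_betw_insert_at[OF insert(1) \<open>M \<notin> S\<close>], of "\<lambda>w. g (tops w)"]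
    by (simp add: case_prod_unfold)
  also have "\<dots> = (\<Sum>w\<in>permutations_of_set S. \<Sum>i\<le>card S. g (tops (insert_at i M w)))"
    by (simp add: sum.cartesian_product)
  also have "\<dots> = (\<Sum>w\<in>permutations_of_set S. G (tops w))"
  proof (rule sum.cong)
    fix w assume w: "w \<in> permutations_of_set S"
    then have "length w = card S" "set w = S" "distinct w"
      using length_finite_permutations_of_set by (auto dest: permutations_of_setD)
    then show "(\<Sum>i\<le>card S. g (tops (insert_at i M w))) = G (tops w)"
      using sum_tops_insert_at[of w M g] insert(2) by (simp add: G_def)
  qed simp
  also have "\<dots> = (\<Sum>\<rho> | \<rho> permutes S. G (drops S \<rho>))" by (rule insert.IH)
  also have "\<dots> = (\<Sum>\<rho> | \<rho> permutes S. \<Sum>b\<in>Set.insert M S.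
      g (drops (Set.insert M S) (transpose M b \<circ> \<rho>)))"
  proof (rule sum.cong)
    fix \<rho> assume "\<rho> \<in> {\<rho>. \<rho> permutes S}"
    then have \<rho>: "\<rho> permutes S" by simp
    have "(\<Sum>b\<in>S. g (drops (Set.insert M S) (transpose M b \<circ> \<rho>)))
        = (\<Sum>a\<in>S. g (drops (Set.insert M S) (transpose M (\<rho> a) \<circ> \<rho>)))"
      by (rule sum.reindex_bij_betw[OF permutes_imp_bij[OF \<rho>], symmetric])
    then show "G (drops S \<rho>) = (\<Sum>b\<in>Set.insert M S. g (drops (Set.insert M S) (transpose M b \<circ> \<rho>)))"
      using insert \<open>M \<notin> S\<close> drops_insert_fixed[OF \<rho> \<open>M \<notin> S\<close>]
      by (simp add: G_def drops_insert_transpose[OF \<rho>])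
  qed simp
  also have "\<dots> = (\<Sum>\<rho> | \<rho> permutes Set.insert M S. g (drops (Set.insert M S) \<rho>))"
    by (subst sum_over_permutations_insert[OF insert(1) \<open>M \<notin> S\<close>]) (rule sum.swap)
  finally show ?case .
qed

lemma bij_betw_map_permutes:
  assumes "distinct xs"
  shows "bij_betw (\<lambda>\<sigma>. map \<sigma> xs) {\<sigma>. \<sigma> permutes set xs} (permutations_of_set (set xs))"
proof -
  have inj: "inj_on (\<lambda>\<sigma>. map \<sigma> xs) {\<sigma>. \<sigma> permutes set xs}"
  proof (rule inj_onI)
    fix \<sigma> \<tau> assume "\<sigma> \<in> {\<sigma>. \<sigma> permutes set xs}" "\<tau> \<in> {\<sigma>. \<sigma> permutes set xs}" "map \<sigma> xs = map \<tau> xs"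
    then show "\<sigma> = \<tau>" by (intro ext) (metis map_eq_conv mem_Collect_eq permutes_not_in)
  qed
  have "(\<lambda>\<sigma>. map \<sigma> xs) ` {\<sigma>. \<sigma> permutes set xs} = permutations_of_set (set xs)"
  proof (rule card_subset_eq)
    show "(\<lambda>\<sigma>. map \<sigma> xs) ` {\<sigma>. \<sigma> permutes set xs} \<subseteq> permutations_of_set (set xs)"
      using assms by (auto intro!: permutations_of_setI 
          simp: permutes_image distinct_map permutes_inj_on permutes_in_image)
    show "card ((\<lambda>\<sigma>. map \<sigma> xs) ` {\<sigma>. \<sigma> permutes set xs}) = card (permutations_of_set (set xs))"
      by (simp add: card_image[OF inj] card_permutations)
  qed simp
  then show ?thesis using inj by (simp add: bij_betw_def)
qed

lemma descent_tops_eq_tops: "descent_tops n \<sigma> = tops (map \<sigma> [1..<n + 2])"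
proof -
  have "descent_tops n \<sigma> = {\<sigma> (Suc i) | i. i < n \<and> \<sigma> (Suc (Suc i)) < \<sigma> (Suc i)}"
    unfolding descent_tops_def
  proof (intro set_eqI iffI; clarsimp)
    fix i assume "Suc 0 \<le> i" "i \<le> n" "\<sigma> (Suc i) < \<sigma> i"
    then show "\<exists>j. \<sigma> i = \<sigma> (Suc j) \<and> j < n \<and> \<sigma> (Suc (Suc j)) < \<sigma> (Suc j)"
      by (intro exI[of _ "i - 1"]) auto
  qed (auto intro!: exI[of _ "Suc _"])
  moreover have nth: "map \<sigma> [1..<n + 2] ! i = \<sigma> (Suc i)" if "i < Suc n" for i
    using that by (simp del: upt_Suc)
  have "tops (map \<sigma> [1..<n + 2]) = {\<sigma> (Suc i) | i. i < n \<and> \<sigma> (Suc (Suc i)) < \<sigma> (Suc i)}"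
    unfolding tops_conv_nth using nth
    by (intro Collect_cong ex_cong1) (auto simp del: upt_Suc nth_map)
  ultimately show ?thesis by simp
qed

lemma sum_descent_tops_eq_sum_drops:
  "(\<Sum>\<sigma> | \<sigma> permutes {1..n + 1}. g (descent_tops n \<sigma>))
   = (\<Sum>\<rho> | \<rho> permutes {1..n + 1}. g (drops {1..n + 1} \<rho>))"
proof -
  have S: "set [1..<n + 2] = {1..n + 1}" by auto
  have "(\<Sum>\<sigma> | \<sigma> permutes {1..n + 1}. g (descent_tops n \<sigma>))
      = (\<Sum>w\<in>permutations_of_set {1..n + 1}. g (tops w))"
    using sum.reindex_bij_betw[OF bij_betw_map_permutes[of "[1..<n + 2]"], of "\<lambda>w. g (tops w)"]
    unfolding S by (simp add: descent_tops_eq_tops)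
  then show ?thesis by (simp add: sum_tops_eq_sum_drops)
qed

lemma descent_tops_subset:
  assumes "\<sigma> permutes {1..n + 1}"
  shows "descent_tops n \<sigma> \<subseteq> {2..n + 1}"
proof
  fix a assume "a \<in> descent_tops n \<sigma>"
  then obtain i where i: "i \<in> {1..n}" "a = \<sigma> i" "\<sigma> (i + 1) < \<sigma> i"
    by (auto simp: descent_tops_def)
  then have "\<sigma> i \<in> {1..n + 1}" "\<sigma> (i + 1) \<in> {1..n + 1}"
    by (auto simp only: permutes_in_image[OF assms]) auto
  then show "a \<in> {2..n + 1}" using i by auto
qed

section \<open>The mirror symmetry\<close>

lemma permutes_of_involution:
  assumes "\<And>v. v \<in> S \<Longrightarrow> f v \<in> S" "\<And>v. v \<in> S \<Longrightarrow> f (f v) = v" "\<And>v. v \<notin> S \<Longrightarrow> f v = v"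
  shows "f permutes S"
  by (rule bij_imp_permutes, rule bij_betwI[of f S S f]) (use assms in auto)

definition flip :: "nat \<Rightarrow> nat \<Rightarrow> nat \<Rightarrow> nat" where
  "flip a b v = (if v \<in> {a..b} then a + b - v else v)"

lemma flip_flip: "flip a b (flip a b v) = v"
  by (auto simp: flip_def)

lemma flip_permutes: "{a..b} \<subseteq> S \<Longrightarrow> flip a b permutes S"
  by (rule permutes_subset[of _ "{a..b}"], rule permutes_of_involution) (auto simp: flip_def)

text \<open>The shift by one between the two reversals is what turns the weak inequality \<open>v \<le> \<rho> v\<close> into the strict
  one that defines drops. The second reversal leaves the value \<open>1\<close> in place because \<open>1\<close> is never a drop.\<close>
lemma drops_flip:
  assumes "\<rho> permutes {1..n + 1}"
  shows "drops {1..n + 1} (flip 1 (n + 1) \<circ> \<rho> \<circ> flip 2 (n + 1))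
       = flip 2 (n + 1) ` ({2..n + 1} - drops {1..n + 1} \<rho>)" (is "?L = flip 2 (n + 1) ` ?R")
proof -
  have iff: "flip 2 (n + 1) v \<in> ?L \<longleftrightarrow> v \<in> ?R" for v
  proof (cases "v \<in> {1..n + 1}")
    case True
    then have "\<rho> v \<in> {1..n + 1}" using permutes_in_image[OF assms] by blast
    then show ?thesis using True by (auto simp: drops_def flip_flip) (auto simp: flip_def split: if_splits)
  next
    case False
    then show ?thesis by (auto simp: drops_def flip_def)
  qed
  have "w \<in> ?L \<longleftrightarrow> w \<in> flip 2 (n + 1) ` ?R" for w
  proof -
    have "w \<in> ?L \<longleftrightarrow> flip 2 (n + 1) w \<in> ?R"
      using iff[of "flip 2 (n + 1) w"] unfolding flip_flip .
    also have "\<dots> \<longleftrightarrow> w \<in> flip 2 (n + 1) ` ?R"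
      by (metis (no_types) flip_flip image_iff)
    finally show ?thesis .
  qed
  then show ?thesis by (rule set_eqI)
qed

lemma sum_descent_tops_mirror:
  "(\<Sum>\<sigma> | \<sigma> permutes {1..n + 1}. g (descent_tops n \<sigma>))
   = (\<Sum>\<sigma> | \<sigma> permutes {1..n + 1}. g (flip 2 (n + 1) ` ({2..n + 1} - descent_tops n \<sigma>)))"
proof -
  let ?P = "{\<rho>. \<rho> permutes {1..n + 1}}"
  have "(\<Sum>\<sigma>\<in>?P. g (descent_tops n \<sigma>)) = (\<Sum>\<rho>\<in>?P. g (drops {1..n + 1} \<rho>))"
    by (rule sum_descent_tops_eq_sum_drops)
  also have "\<dots> = (\<Sum>\<rho>\<in>?P. g (drops {1..n + 1} (flip 1 (n + 1) \<circ> \<rho>)))"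
    by (rule setum_permutations_compose_left) (rule flip_permutes, simp)
  also have "\<dots> = (\<Sum>\<rho>\<in>?P. g (drops {1..n + 1} (flip 1 (n + 1) \<circ> (\<rho> \<circ> flip 2 (n + 1)))))"
    by (rule sum_permutations_compose_right) (rule flip_permutes, simp)
  also have "\<dots> = (\<Sum>\<rho>\<in>?P. g (flip 2 (n + 1) ` ({2..n + 1} - drops {1..n + 1} \<rho>)))"
    by (rule sum.cong) (use drops_flip in \<open>auto simp: comp_assoc\<close>)
  also have "\<dots> = (\<Sum>\<sigma>\<in>?P. g (flip 2 (n + 1) ` ({2..n + 1} - descent_tops n \<sigma>)))"
    by (rule sum_descent_tops_eq_sum_drops[symmetric])
  finally show ?thesis .
qed

text \<open>The decreasing permutation makes the full product of the variables occur in the Eulerian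
  polynomial; this pins down the monomial that clears denominators in its reciprocal.\<close>
lemma descent_tops_flip: "descent_tops n (flip 1 (n + 1)) = {2..n + 1}"
proof (intro equalityI subsetI)
  fix a assume "a \<in> descent_tops n (flip 1 (n + 1))"
  then show "a \<in> {2..n + 1}" using descent_tops_subset[OF flip_permutes[of 1 "n + 1"]] by blast
next
  fix a assume "a \<in> {2..n + 1}"
  then show "a \<in> descent_tops n (flip 1 (n + 1))"
    unfolding descent_tops_def by (auto simp: flip_def intro!: exI[of _ "n + 2 - a"])
qed

section \<open>Substitution into square-free polynomials\<close>

definition indicator_exponent :: "nat set \<Rightarrow> (nat \<Rightarrow>\<^sub>0 'e::comm_semiring_1)" where
  "indicator_exponent D = (\<Sum>i\<in>D. Poly_Mapping.single i 1)"

lemma lookup_indicator_exponent: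
  "finite D \<Longrightarrow> Poly_Mapping.lookup (indicator_exponent D) i = (if i \<in> D then 1 else 0)"
  by (simp add: indicator_exponent_def lookup_sum lookup_single when_def)

lemma keys_indicator_exponent:
  "finite D \<Longrightarrow> Poly_Mapping.keys (indicator_exponent D :: nat \<Rightarrow>\<^sub>0 'e::comm_semiring_1) = D"
  by (auto simp: in_keys_iff lookup_indicator_exponent split: if_splits)

lemma prod_single:
  "(\<Prod>i\<in>D. Poly_Mapping.single (e i) (1::'c::comm_semiring_1))
   = Poly_Mapping.single (\<Sum>i\<in>D. e i :: 'k::comm_monoid_add) 1"
  by (induction D rule: infinite_finite_induct) (simp_all add: mult_single)

lemma prod_X: "(\<Prod>i\<in>D. X i) = Poly_Mapping.single (indicator_exponent D) 1"
  by (simp add: X_def prod_single indicator_exponent_def)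

lemma msubst_conv_superset:
  assumes "finite K" "Poly_Mapping.keys p \<subseteq> K"
  shows "msubst f p = (\<Sum>m\<in>K. Poly_Mapping.single 0 (Poly_Mapping.lookup p m) *
     (\<Prod>i\<in>Poly_Mapping.keys m. f i ^ Poly_Mapping.lookup m i))"
  unfolding msubst_def using assms by (intro sum.mono_neutral_left) (auto simp: in_keys_iff)

lemma msubst_add: "msubst f (p + q) = msubst f p + msubst f q"
proof -
  let ?K = "Poly_Mapping.keys p \<union> Poly_Mapping.keys q"
  show ?thesis
    by (subst (1 2 3) msubst_conv_superset[of ?K])
      (auto simp: sum.distrib[symmetric] lookup_add single_add distrib_right dest: keys_add[THEN subsetD])
qed

lemma msubst_sum: "msubst f (\<Sum>s\<in>F. p s) = (\<Sum>s\<in>F. msubst f (p s))"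
proof (induction F rule: infinite_finite_induct)
  case (insert s F)
  then show ?case by (simp add: msubst_add)
qed (simp_all add: msubst_def)

lemma msubst_prod_X:
  "finite D \<Longrightarrow> msubst f (\<Prod>i\<in>D. X i) = (\<Prod>i\<in>D. f i)"
  by (simp add: prod_X msubst_def keys_indicator_exponent lookup_indicator_exponent)

section \<open>Embedding polynomials into Laurent polynomials\<close>

definition int_exponent :: "(nat \<Rightarrow>\<^sub>0 nat) \<Rightarrow> (nat \<Rightarrow>\<^sub>0 int)" where
  "int_exponent m = Poly_Mapping.map int m"

lemma lookup_int_exponent [simp]:
  "Poly_Mapping.lookup (int_exponent m) i = int (Poly_Mapping.lookup m i)"
  by (simp add: int_exponent_def Poly_Mapping.map.rep_eq when_def)

lemma inj_int_exponent: "int_exponent m = int_exponent m' \<longleftrightarrow> m = m'"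
  by (auto simp: poly_mapping_eq_iff fun_eq_iff dest!: arg_cong[of _ _ Poly_Mapping.lookup])

lemma int_exponent_indicator:
  "finite D \<Longrightarrow> int_exponent (indicator_exponent D) = indicator_exponent D"
  by (rule poly_mapping_eqI) (simp add: lookup_indicator_exponent)

lemma single_power:
  "Poly_Mapping.single (Poly_Mapping.single i (c::int)) (1::real) ^ k
   = Poly_Mapping.single (Poly_Mapping.single (i::nat) (of_nat k * c)) 1"
  by (induction k) (simp_all add: mult_single single_add[symmetric] distrib_right)

lemma sum_single_lookup:
  "(\<Sum>i\<in>Poly_Mapping.keys m. Poly_Mapping.single i (int (Poly_Mapping.lookup m i))) = int_exponent m"
  by (rule poly_mapping_eqI) (simp add: lookup_sum lookup_single when_def in_keys_iff)

lemma to_laurent_conv_sum: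
  "to_laurent p = (\<Sum>m\<in>Poly_Mapping.keys p. Poly_Mapping.single (int_exponent m) (Poly_Mapping.lookup p m))"
  by (simp add: to_laurent_def msubst_def LX_def single_power prod_single sum_single_lookup mult_single)

lemma lookup_to_laurent:
  "Poly_Mapping.lookup (to_laurent p) (int_exponent m) = Poly_Mapping.lookup p m"
  by (simp add: to_laurent_conv_sum lookup_sum lookup_single when_def inj_int_exponent in_keys_iff)

lemma inj_to_laurent_iff: "to_laurent p = to_laurent q \<longleftrightarrow> p = q"
  by (metis lookup_to_laurent poly_mapping_eqI)

text \<open>This is how membership in the range of the embedding is refuted.\<close>
lemma lookup_to_laurent_nonneg:
  assumes "Poly_Mapping.lookup (to_laurent p) e \<noteq> 0"
  shows "Poly_Mapping.lookup e i \<ge> 0"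
proof -
  obtain m where "e = int_exponent m"
    using assms unfolding to_laurent_conv_sum lookup_sum
    by (elim sum.not_neutral_contains_not_neutral) (auto simp: lookup_single when_def split: if_splits)
  then show ?thesis by simp
qed

section \<open>Reciprocals of square-free polynomials\<close>

lemma rec_product_squarefree:
  assumes "\<And>s. s \<in> F \<Longrightarrow> finite (D s)"
  shows "rec_product m (\<Sum>s\<in>F. \<Prod>i\<in>D s. X i)
       = (\<Sum>s\<in>F. Poly_Mapping.single (int_exponent m - indicator_exponent (D s)) 1)"
proof -
  have "msubst LX_inv (\<Sum>s\<in>F. \<Prod>i\<in>D s. X i) = (\<Sum>s\<in>F. Poly_Mapping.single (- indicator_exponent (D s)) 1)"
    using assms by (simp add: msubst_sum msubst_prod_X LX_inv_def prod_single indicator_exponent_def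
        single_uminus sum_negf)
  moreover have "to_laurent (monomial m) = Poly_Mapping.single (int_exponent m) 1"
    by (simp add: to_laurent_conv_sum monomial_def)
  ultimately show ?thesis by (simp add: rec_product_def sum_distrib_left mult_single)
qed

lemma rec_product_indicator:
  assumes "finite T" "\<And>s. s \<in> F \<Longrightarrow> D s \<subseteq> T"
  shows "rec_product (indicator_exponent T) (\<Sum>s\<in>F. \<Prod>i\<in>D s. X i)
       = to_laurent (\<Sum>s\<in>F. \<Prod>i\<in>T - D s. X i)"
proof -
  have fin: "finite (D s)" if "s \<in> F" for s using assms that finite_subset by blast
  have "indicator_exponent T - indicator_exponent (D s) = (indicator_exponent (T - D s) :: nat \<Rightarrow>\<^sub>0 int)"
    if "s \<in> F" for s
    unfolding indicator_exponent_def using assms(1) assms(2)[OF that]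
    by (simp add: sum_diff)
  then show ?thesis
    using assms(1) fin
    by (simp add: rec_product_squarefree int_exponent_indicator to_laurent_def msubst_sum msubst_prod_X
       LX_def prod_single) (simp add: indicator_exponent_def)
qed

text \<open>Among the monomials divisible by every variable of \<open>T\<close>, their product is the unique one of least
  degree.\<close>
lemma mdegree_superset:
  assumes "finite T" "\<And>i. i \<in> T \<Longrightarrow> Poly_Mapping.lookup m i \<ge> 1"
  shows "card T \<le> mdegree m" and "mdegree m \<le> card T \<Longrightarrow> m = indicator_exponent T"
proof -
  have sub: "T \<subseteq> Poly_Mapping.keys m" using assms(2) by (force simp: in_keys_iff)
  have split: "mdegree m = card T + (\<Sum>i\<in>T. Poly_Mapping.lookup m i - 1)
      + (\<Sum>i\<in>Poly_Mapping.keys m - T. Poly_Mapping.lookup m i)"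
  proof -
    have "(\<Sum>i\<in>T. Poly_Mapping.lookup m i) = (\<Sum>i\<in>T. 1 + (Poly_Mapping.lookup m i - 1))"
      using assms(2) by (intro sum.cong) (simp_all add: le_add_diff_inverse del: One_nat_def)
    then show ?thesis
      using sum.subset_diff[OF sub, of "Poly_Mapping.lookup m"] 
      by (simp only: mdegree_def sum.distrib) simp
  qed
  then show "card T \<le> mdegree m" by simp
  assume "mdegree m \<le> card T"
  then have "\<forall>i\<in>T. Poly_Mapping.lookup m i - 1 = 0" 
    "\<forall>i\<in>Poly_Mapping.keys m - T. Poly_Mapping.lookup m i = 0"
    using split assms(1) by (auto simp: sum_eq_0_iff simp flip: in_keys_iff)
  then show "m = indicator_exponent T"
    using assms by (intro poly_mapping_eqI) 
      (force simp: lookup_indicator_exponent in_keys_iff intro: antisym)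
qed

text \<open>Substituting \<open>1/x\<^sub>i\<close> makes the product of the variables in \<open>T\<close> occur in a denominator, with a positive
  coefficient since nothing cancels. So the clearing monomial must be divisible by every variable in
  \<open>T\<close>, and their product already clears every denominator because \<open>D s \<subseteq> T\<close>.\<close>
lemma reciprocal_squarefree:
  assumes "finite F" "finite T" "\<And>s. s \<in> F \<Longrightarrow> D s \<subseteq> T" "t \<in> F" "D t = T"
  shows "reciprocal (\<Sum>s\<in>F. \<Prod>i\<in>D s. X i) = (\<Sum>s\<in>F. \<Prod>i\<in>T - D s. X i)"
proof -
  define p where "p = (\<Sum>s\<in>F. \<Prod>i\<in>D s. X i)"
  have fin: "finite (D s)" if "s \<in> F" for s using assms that finite_subset by blast
  have ge: "Poly_Mapping.lookup m i \<ge> 1" if "rec_product m p \<in> range to_laurent" "i \<in> T" for m i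
  proof -
    \<comment> \<open>the exponent contributed by \<open>t\<close>\<close>
    let ?e = "int_exponent m - indicator_exponent T"
    have "Poly_Mapping.lookup (rec_product m p) ?e
        = (\<Sum>s\<in>F. if int_exponent m - indicator_exponent (D s) = ?e then 1 else 0)"
      unfolding p_def using fin by (simp add: rec_product_squarefree lookup_sum lookup_single when_def)
    also have "\<dots> > 0" using assms by (intro sum_pos2[of _ t]) auto
    finally have "Poly_Mapping.lookup (rec_product m p) ?e \<noteq> 0" by simp
    then have "Poly_Mapping.lookup ?e i \<ge> 0"
      using that(1) by (elim rangeE) (simp only: lookup_to_laurent_nonneg)
    then show ?thesis using that(2) assms(2) by (simp add: lookup_minus lookup_indicator_exponent)
  qed
  have T: "rec_product (indicator_exponent T) p = to_laurent (\<Sum>s\<in>F. \<Prod>i\<in>T - D s. X i)"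
    unfolding p_def using assms by (intro rec_product_indicator) auto
  have deg: "mdegree (indicator_exponent T) = card T"
    using assms(2) by (simp add: mdegree_def keys_indicator_exponent lookup_indicator_exponent)
  have "rec_monomial p = indicator_exponent T"
    unfolding rec_monomial_def
  proof (rule the_equality)
    show "is_arg_min mdegree (\<lambda>m. rec_product m p \<in> range to_laurent) (indicator_exponent T)"
      using T deg mdegree_superset(1)[OF assms(2) ge] by (auto simp: is_arg_min_def not_less)
  next
    fix m assume m: "is_arg_min mdegree (\<lambda>m. rec_product m p \<in> range to_laurent) m"
    then have "mdegree m \<le> card T" using T deg unfolding is_arg_min_def
      by (metis not_le rangeI)
    then show "m = indicator_exponent T"
      using m mdegree_superset(2)[OF assms(2) ge] by (auto simp: is_arg_min_def)
  qed
  then show ?thesis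
    unfolding reciprocal_def p_def[symmetric] using T by (simp add: inj_to_laurent_iff)
qed

section \<open>The Eulerian polynomial\<close>

lemma mirror_var_upt:
  assumes "i \<in> {2..<n + 2}"
  shows "mirror_var [2..<n + 2] i = n + 3 - i"
proof -
  let ?vs = "[2..<n + 2]"
  have "map_of (zip ?vs (rev ?vs)) (?vs ! (i - 2)) = Some (rev ?vs ! (i - 2))"
    using assms by (intro map_of_zip_nth) auto
  moreover have "?vs ! (i - 2) = i" "rev ?vs ! (i - 2) = n + 3 - i"
    using assms by (auto simp: rev_nth simp del: upt_Suc)
  ultimately show ?thesis by (simp add: mirror_var_def del: upt_Suc)
qed

lemma vars_eulerian: "vars (eulerian n) \<subseteq> {2..n + 1}"
proof
  fix i assume "i \<in> vars (eulerian n)"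
  then obtain m where m: "m \<in> Poly_Mapping.keys (eulerian n)" "i \<in> Poly_Mapping.keys m"
    by (auto simp: vars_def)
  obtain \<sigma> where \<sigma>: "\<sigma> permutes {1..n + 1}" "m = indicator_exponent (descent_tops n \<sigma>)"
    using m(1) keys_sum[of "\<lambda>\<sigma>. \<Prod>i\<in>descent_tops n \<sigma>. X i" "{\<sigma>. \<sigma> permutes {1..n + 1}}"]
    by (auto simp: eulerian_def prod_X)
  have "finite (descent_tops n \<sigma>)" using descent_tops_subset[OF \<sigma>(1)] finite_subset by blast
  then show "i \<in> {2..n + 1}"
    using m(2) \<sigma> descent_tops_subset[OF \<sigma>(1)] by (auto simp: keys_indicator_exponent)
qed

lemma reciprocal_eulerian:
  "reciprocal (eulerian n)
   = (\<Sum>\<sigma> | \<sigma> permutes {1..n + 1}. \<Prod>i\<in>{2..n + 1} - descent_tops n \<sigma>. X i)"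
  unfolding eulerian_def
  by (rule reciprocal_squarefree[where t = "flip 1 (n + 1)"])
    (use descent_tops_subset flip_permutes[of 1 "n + 1"] descent_tops_flip in \<open>auto simp: finite_permutations\<close>)

text \<open>Mirroring is applied twice, once by the substitution and once by the symmetry of the distribution,
  and the two cancel; only the complement remains. The hypothesis constrains \<open>f\<close> just on the variables
  that occur, so the lemma covers both ways of writing the mirrored tuple.\<close>
lemma msubst_eulerian:
  assumes "\<And>i. i \<in> {2..n + 1} \<Longrightarrow> f i = X (n + 3 - i)"
  shows "msubst f (eulerian n) = reciprocal (eulerian n)"
proof -
  have "msubst f (eulerian n)
      = (\<Sum>\<sigma> | \<sigma> permutes {1..n + 1}. \<Prod>i\<in>descent_tops n \<sigma>. X (flip 2 (n + 1) i))"
    unfolding eulerian_def msubst_sum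
  proof (rule sum.cong)
    fix \<sigma> assume "\<sigma> \<in> {\<sigma>. \<sigma> permutes {1..n + 1}}"
    then have D: "descent_tops n \<sigma> \<subseteq> {2..n + 1}" using descent_tops_subset by blast
    then have "finite (descent_tops n \<sigma>)" using finite_subset by blast
    moreover have "f i = X (flip 2 (n + 1) i)" if "i \<in> descent_tops n \<sigma>" for i
      using D that assms[of i] by (auto simp: flip_def eval_nat_numeral)
    ultimately show "msubst f (\<Prod>i\<in>descent_tops n \<sigma>. X i)
        = (\<Prod>i\<in>descent_tops n \<sigma>. X (flip 2 (n + 1) i))" by (simp add: msubst_prod_X)
  qed simp
  also have "\<dots> = (\<Sum>\<sigma> | \<sigma> permutes {1..n + 1}.
      \<Prod>i\<in>flip 2 (n + 1) ` ({2..n + 1} - descent_tops n \<sigma>). X (flip 2 (n + 1) i))"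
    by (rule sum_descent_tops_mirror)
  also have "\<dots> = reciprocal (eulerian n)"
  proof -
    have "inj_on (flip 2 (n + 1)) A" for A by (metis flip_flip inj_onI)
    then show ?thesis by (simp add: reciprocal_eulerian prod.reindex flip_flip)
  qed
  finally show ?thesis .
qed

theorem theorem6p2:
  fixes n :: nat
  shows "mirrorpalindromic [2..<n + 2] (eulerian n) \<and>
    reciprocal (eulerian n) = msubst (\<lambda>i. X (n + 3 - i)) (eulerian n)"
proof
  have "msubst (\<lambda>i. X (mirror_var [2..<n + 2] i)) (eulerian n) = reciprocal (eulerian n)"
  proof (rule msubst_eulerian)
    fix i assume "i \<in> {2..n + 1}"
    then have "i \<in> {2..<n + 2}" by auto
    then show "X (mirror_var [2..<n + 2] i) = X (n + 3 - i)" by (simp only: mirror_var_upt)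
  qed
  moreover have "vars (eulerian n) \<subseteq> set [2..<n + 2]"
    using vars_eulerian[of n] by auto
  ultimately show "mirrorpalindromic [2..<n + 2] (eulerian n)"
    by (simp only: mirrorpalindromic_def distinct_upt simp_thms)
  show "reciprocal (eulerian n) = msubst (\<lambda>i. X (n + 3 - i)) (eulerian n)"
    by (rule msubst_eulerian[symmetric]) simp
qed

end
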